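(* Let $X$ and $Y$ be real Banach spaces, and let $(x,y) \in S_{X \oplus_\infty Y}$. Then $dc((x,y)) \geq dc(x)$ when $\|x\|=1$, and $dc((x,y)) \geq dc(y)$ when $\|y\|=1$.
   Context: $X\oplus_\infty Y$ is $X\times Y$ with norm $\|(x,y)\|=\max\{\|x\|,\|y\|\}$. For a Banach space $Z$, $B_Z$, $S_Z$, $Z^*$ denote the closed unit ball, unit sphere and topological dual. A slice of $B_Z$ is a set $S(z^*,\delta)=\{w\in B_Z : z^*(w)>1-\delta\}$ with $z^*\in S_{Z^*}$ and $\delta>0$. For $z\in B_Z$, the Daugavet constant $dc(z)$ (computed in the space $Z$ in which $z$ lies) is the supremum of all $\alpha\ge 0$ such that for all $\varepsilon,\delta>0$ and all $z^*\in S_{Z^*}$ there exists $w\in S(z^*,\delta)$ with $\|w-z\|>\alpha-\varepsilon$. *)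

theory Defs
  imports "HOL-Analysis.Analysis"
begin

(* The library's product type carries the Euclidean norm, so the
   max-normed direct sum needs a type of its own. *)

datatype ('a, 'b) inf_sum (infixr \<open>\<oplus>\<^sub>\<infinity>\<close> 20) =
  Inf_Pair (inf_fst: 'a) (inf_snd: 'b)

instantiation inf_sum :: (real_vector, real_vector) real_vector
begin

definition "0 = Inf_Pair 0 0"
definition "p + q = Inf_Pair (inf_fst p + inf_fst q) (inf_snd p + inf_snd q)"
definition "p - q = Inf_Pair (inf_fst p - inf_fst q) (inf_snd p - inf_snd q)"
definition "- p = Inf_Pair (- inf_fst p) (- inf_snd p)"
definition "r *\<^sub>R p = Inf_Pair (r *\<^sub>R inf_fst p) (r *\<^sub>R inf_snd p)"

instance
  by standard
    (simp_all add: zero_inf_sum_def plus_inf_sum_def minus_inf_sum_def uminus_inf_sum_def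
      scaleR_inf_sum_def scaleR_add_left scaleR_add_right add_ac)

end

instantiation inf_sum :: (real_normed_vector, real_normed_vector) real_normed_vector
begin

definition "norm p = max (norm (inf_fst p)) (norm (inf_snd p))"
definition "sgn (p :: 'a \<oplus>\<^sub>\<infinity> 'b) = p /\<^sub>R norm p"
definition "dist (p :: 'a \<oplus>\<^sub>\<infinity> 'b) q = norm (p - q)"
definition "(uniformity :: (('a \<oplus>\<^sub>\<infinity> 'b) \<times> ('a \<oplus>\<^sub>\<infinity> 'b)) filter) =
  (INF e\<in>{0<..}. principal {(p, q). dist p q < e})"
definition "open (U :: ('a \<oplus>\<^sub>\<infinity> 'b) set) \<longleftrightarrow>
  (\<forall>p\<in>U. eventually (\<lambda>(p', q). p' = p \<longrightarrow> q \<in> U) uniformity)"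

instance
proof
  fix p q :: "'a \<oplus>\<^sub>\<infinity> 'b" and r :: real
  show "norm p = 0 \<longleftrightarrow> p = 0"
    by (cases p) (auto simp: norm_inf_sum_def zero_inf_sum_def max_def)
  have "norm (inf_fst p + inf_fst q) \<le> norm (inf_fst p) + norm (inf_fst q)"
    "norm (inf_snd p + inf_snd q) \<le> norm (inf_snd p) + norm (inf_snd q)"
    by (rule norm_triangle_ineq)+
  then show "norm (p + q) \<le> norm p + norm q"
    unfolding norm_inf_sum_def plus_inf_sum_def inf_sum.sel by linarith
  show "norm (r *\<^sub>R p) = \<bar>r\<bar> * norm p"
    by (simp add: norm_inf_sum_def scaleR_inf_sum_def max_mult_distrib_left)
qed (fact sgn_inf_sum_def dist_inf_sum_def uniformity_inf_sum_def open_inf_sum_def)+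

end

instance inf_sum :: (banach, banach) banach
proof
  fix X :: "nat \<Rightarrow> 'a \<oplus>\<^sub>\<infinity> 'b"
  assume X: "Cauchy X"
  have le: "dist (inf_fst p) (inf_fst q) \<le> dist p q" "dist (inf_snd p) (inf_snd q) \<le> dist p q"
    for p q :: "'a \<oplus>\<^sub>\<infinity> 'b"
    by (simp_all add: dist_norm norm_inf_sum_def minus_inf_sum_def)
  have "Cauchy (\<lambda>n. inf_fst (X n))"
    using X unfolding Cauchy_def by (blast intro: le_less_trans[OF le(1)])
  then obtain a where a: "(\<lambda>n. inf_fst (X n)) \<longlonglongrightarrow> a"
    by (auto simp: Cauchy_convergent_iff convergent_def)
  have "Cauchy (\<lambda>n. inf_snd (X n))"
    using X unfolding Cauchy_def by (blast intro: le_less_trans[OF le(2)])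
  then obtain b where b: "(\<lambda>n. inf_snd (X n)) \<longlonglongrightarrow> b"
    by (auto simp: Cauchy_convergent_iff convergent_def)
  have "(\<lambda>n. max (norm (inf_fst (X n) - a)) (norm (inf_snd (X n) - b))) \<longlonglongrightarrow> max 0 0"
    using a b by (intro tendsto_max tendsto_norm_zero LIM_zero)
  then have "(\<lambda>n. norm (X n - Inf_Pair a b)) \<longlonglongrightarrow> 0"
    by (simp add: norm_inf_sum_def minus_inf_sum_def)
  then have "X \<longlonglongrightarrow> Inf_Pair a b"
    unfolding tendsto_dist_iff[of X] dist_norm .
  then show "convergent X"
    by (rule convergentI)
qed

definition slice :: "('a::banach \<Rightarrow>\<^sub>L real) \<Rightarrow> real \<Rightarrow> 'a set"
  where "slice f \<delta> = {w \<in> cball 0 1. blinfun_apply f w > 1 - \<delta>}"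

(* The supremum is taken in the extended reals: in the zero space there are no
   norm-one functionals, every \<alpha> qualifies and the value is \<infinity>. *)
definition dc :: "'a::banach \<Rightarrow> ereal"
  where "dc z = Sup (ereal ` {\<alpha>. \<alpha> \<ge> 0 \<and>
    (\<forall>\<epsilon>>0. \<forall>\<delta>>0. \<forall>f\<in>sphere (0 :: 'a \<Rightarrow>\<^sub>L real) 1. \<exists>w\<in>slice f \<delta>. norm (w - z) > \<alpha> - \<epsilon>)})"

end

(* A norm-one functional f on the max-sum of X and Y splits as f(u, v) = g u + h v with
   |g| + |h| = 1.  If g is nonzero, a far point u of a slice given by g / |g|, paired with a v
   that almost norms h, is a far point of the given slice.  If g = 0 the first coordinate is free
   and u = -x is at distance 2 from x, which exceeds alpha - epsilon because X has a norm-one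
   functional, so that no alpha > 2 qualifies for x.

   That functional is a minimal element, given by Zorn's lemma, among the sublinear functions
   below the norm whose value at -x is at most -|x|: minimality forces linearity. *)

theory Submission
  imports Defs
begin

section \<open>Norming functionals\<close>

text \<open>Homogeneity is required only as an inequality for \<open>t > 0\<close>, the form that
  passes directly to infima; equality follows by applying it to \<open>inverse t\<close> as
  well.\<close>

definition norm_bounded_sublinear :: "('a::real_normed_vector \<Rightarrow> real) \<Rightarrow> bool"
  where "norm_bounded_sublinear q \<longleftrightarrow>
    (\<forall>x y. q (x + y) \<le> q x + q y) \<and> (\<forall>t>0. \<forall>x. q (t *\<^sub>R x) \<le> t * q x) \<and> (\<forall>x. q x \<le> norm x)"

context
  fixes q :: "'a::real_normed_vector \<Rightarrow> real"
  assumes q: "norm_bounded_sublinear q"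
begin

lemma sublinear_add: "q (x + y) \<le> q x + q y"
  using q by (simp add: norm_bounded_sublinear_def)

lemma sublinear_le_norm: "q x \<le> norm x"
  using q by (simp add: norm_bounded_sublinear_def)

lemma sublinear_scaleR_le: "t > 0 \<Longrightarrow> q (t *\<^sub>R x) \<le> t * q x"
  using q by (simp add: norm_bounded_sublinear_def)

lemma sublinear_zero: "q 0 = 0"
  using sublinear_add[of 0 0] sublinear_le_norm[of 0] by simp

lemma sublinear_minus: "- q (- x) \<le> q x"
  using sublinear_add[of x "- x"] by (simp add: sublinear_zero)

lemma sublinear_ge_norm: "- norm x \<le> q x"
  using sublinear_minus[of x] sublinear_le_norm[of "- x"] by simp

lemma sublinear_scaleR:
  assumes "t \<ge> 0"
  shows "q (t *\<^sub>R x) = t * q x"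
proof (cases "t = 0")
  case False
  with assms have "t > 0" by simp
  have "q x \<le> inverse t * q (t *\<^sub>R x)"
    using sublinear_scaleR_le[of "inverse t" "t *\<^sub>R x"] \<open>t > 0\<close> by simp
  then have "t * q x \<le> q (t *\<^sub>R x)"
    using \<open>t > 0\<close> by (simp add: field_simps)
  with sublinear_scaleR_le[OF \<open>t > 0\<close>, of x] show ?thesis by simp
qed (simp add: sublinear_zero)

text \<open>The standard lowering of a sublinear function in the direction \<open>a\<close>. Applied
  to \<open>norm\<close> it gives the starting point for Zorn's lemma; applied to a minimal
  \<open>q\<close> it shows that \<open>q\<close> is odd.\<close>

lemma sublinear_decrease:
  obtains r where "norm_bounded_sublinear r" "\<And>x. r x \<le> q x" "r (- a) \<le> - q a"
proof -
  define r where "r x = (INF t\<in>{0..}. q (x + t *\<^sub>R a) - t * q a)" for x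
  \<comment> \<open>A lower bound independent of \<open>t\<close> makes the infimum a genuine
    greatest lower bound.\<close>
  have "- q (- x) \<le> q (x + t *\<^sub>R a) - t * q a" if "t \<ge> 0" for x t
    using sublinear_add[of "x + t *\<^sub>R a" "- x"] sublinear_scaleR[OF that, of a] by simp
  then have "bdd_below ((\<lambda>t. q (x + t *\<^sub>R a) - t * q a) ` {0..})" for x
    by (intro bdd_belowI2[where m = "- q (- x)"]) auto
  then have le: "r x \<le> q (x + t *\<^sub>R a) - t * q a" if "t \<ge> 0" for x t
    unfolding r_def using that by (intro cINF_lower) auto
  have ge: "m \<le> r x" if "\<And>t. t \<ge> 0 \<Longrightarrow> m \<le> q (x + t *\<^sub>R a) - t * q a" for m x
    unfolding r_def using that by (intro cINF_greatest) auto
  have r_le: "r x \<le> q x" for x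
    using le[of 0 x] by simp
  have "r (x + y) \<le> r x + r y" for x y
  proof -
    \<comment> \<open>The parameter \<open>s + t\<close> competes in the infimum for
      \<open>x + y\<close>; the infima over \<open>t\<close> and \<open>s\<close> are then taken one
      after the other.\<close>
    have "r (x + y) - (q (x + s *\<^sub>R a) - s * q a) \<le> q (y + t *\<^sub>R a) - t * q a"
      if "s \<ge> 0" "t \<ge> 0" for s t
      using le[of "s + t" "x + y"] sublinear_add[of "x + s *\<^sub>R a" "y + t *\<^sub>R a"] that
      by (simp add: algebra_simps)
    then have "r (x + y) - (q (x + s *\<^sub>R a) - s * q a) \<le> r y" if "s \<ge> 0" for s
      using that by (intro ge)
    then have "r (x + y) - r y \<le> r x"
      by (intro ge) (simp add: algebra_simps)
    then show ?thesis by simp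
  qed
  moreover have "r (c *\<^sub>R x) \<le> c * r x" if "c > 0" for c x
  proof -
    have "r (c *\<^sub>R x) / c \<le> q (x + t *\<^sub>R a) - t * q a" if "t \<ge> 0" for t
    proof -
      \<comment> \<open>The parameter \<open>c * t\<close> lets \<open>c\<close> be factored
        out.\<close>
      have "r (c *\<^sub>R x) \<le> q (c *\<^sub>R x + (c * t) *\<^sub>R a) - c * t * q a"
        using \<open>c > 0\<close> that by (intro le) simp
      also have "\<dots> = c * (q (x + t *\<^sub>R a) - t * q a)"
        using sublinear_scaleR[of c "x + t *\<^sub>R a"] \<open>c > 0\<close> by (simp add: algebra_simps)
      finally show ?thesis
        using \<open>c > 0\<close> by (simp add: divide_le_eq mult.commute)
    qed
    then have "r (c *\<^sub>R x) / c \<le> r x"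
      by (rule ge)
    with that show ?thesis
      by (simp add: divide_le_eq mult.commute)
  qed
  ultimately have "norm_bounded_sublinear r"
    unfolding norm_bounded_sublinear_def using r_le sublinear_le_norm order_trans by blast
  moreover have "r (- a) \<le> - q a"
    using le[of 1 "- a"] by (simp add: sublinear_zero)
  ultimately show ?thesis
    using that r_le by blast
qed

end

text \<open>The common lower bound \<open>- norm x\<close> keeps the infimum finite. Subadditivity
  uses the chain condition: the values \<open>q x\<close> and \<open>p y\<close> both dominate those
  of the smaller of \<open>p\<close> and \<open>q\<close>.\<close>

lemma norm_bounded_sublinear_INF:
  fixes C :: "('a::real_normed_vector \<Rightarrow> real) set"
  assumes "C \<noteq> {}" and C: "\<And>q. q \<in> C \<Longrightarrow> norm_bounded_sublinear q"
    and chain: "\<And>p q. p \<in> C \<Longrightarrow> q \<in> C \<Longrightarrow> p \<le> q \<or> q \<le> p"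
  defines "r \<equiv> (\<lambda>x. INF q\<in>C. q x)"
  shows "norm_bounded_sublinear r" and "q \<in> C \<Longrightarrow> r \<le> q"
proof -
  have "bdd_below ((\<lambda>q. q x) ` C)" for x
    by (intro bdd_belowI2[where m = "- norm x"] sublinear_ge_norm C)
  then have le: "r x \<le> q x" if "q \<in> C" for q x
    unfolding r_def using that by (intro cINF_lower)
  have ge: "m \<le> r x" if "\<And>q. q \<in> C \<Longrightarrow> m \<le> q x" for m x
    unfolding r_def using that \<open>C \<noteq> {}\<close> by (intro cINF_greatest)
  show "r \<le> q" if "q \<in> C"
    using le[OF that] by (simp add: le_fun_def)
  have "r (x + y) \<le> r x + r y" for x y
  proof -
    have "r (x + y) - q x \<le> p y" if pq: "p \<in> C" "q \<in> C" for p q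
    proof -
      obtain s where "s \<in> C" "s \<le> p" "s \<le> q"
        using chain[OF pq] pq by blast
      have "r (x + y) \<le> s x + s y"
        using le[OF \<open>s \<in> C\<close>] sublinear_add[OF C[OF \<open>s \<in> C\<close>]] order_trans by blast
      then show ?thesis
        using le_funD[OF \<open>s \<le> p\<close>, of y] le_funD[OF \<open>s \<le> q\<close>, of x] by linarith
    qed
    then have "r (x + y) - q x \<le> r y" if "q \<in> C" for q
      using that by (intro ge)
    then have "r (x + y) - r y \<le> r x"
      by (intro ge) (simp add: algebra_simps)
    then show ?thesis by simp
  qed
  moreover have "r (c *\<^sub>R x) \<le> c * r x" if "c > 0" for c x
  proof -
    have "r (c *\<^sub>R x) / c \<le> q x" if "q \<in> C" for q
      using le[OF that, of "c *\<^sub>R x"] sublinear_scaleR_le[OF C[OF that] \<open>c > 0\<close>, of x] \<open>c > 0\<close>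
      by (simp add: divide_le_eq mult.commute)
    then have "r (c *\<^sub>R x) / c \<le> r x"
      by (rule ge)
    with that show ?thesis
      by (simp add: divide_le_eq mult.commute)
  qed
  moreover have "r x \<le> norm x" for x
    using \<open>C \<noteq> {}\<close> le C sublinear_le_norm order_trans by blast
  ultimately show "norm_bounded_sublinear r"
    by (simp add: norm_bounded_sublinear_def)
qed

text \<open>Zorn's lemma for the reversed pointwise order: a nonempty chain is bounded by its
  pointwise infimum, the empty one by \<open>p\<close>.\<close>

lemma ex_minimal_sublinear:
  fixes p :: "'a::real_normed_vector \<Rightarrow> real"
  assumes "norm_bounded_sublinear p"
  obtains q where "norm_bounded_sublinear q" "q \<le> p"
    "\<And>r. norm_bounded_sublinear r \<Longrightarrow> r \<le> q \<Longrightarrow> r = q"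
proof -
  define A where "A = {q. norm_bounded_sublinear q \<and> q \<le> p}"
  have "\<exists>m\<in>A. \<forall>a\<in>A. a \<le> m \<longrightarrow> a = m"
  proof (rule predicate_Zorn)
    show "partial_order_on A (relation_of (\<lambda>a b. b \<le> a) A)"
      by (rule partial_order_on_relation_ofI) auto
    fix C assume "C \<in> Chains (relation_of (\<lambda>a b. b \<le> a) A)"
    then have CA: "C \<subseteq> A" and chain: "\<And>a b. a \<in> C \<Longrightarrow> b \<in> C \<Longrightarrow> a \<le> b \<or> b \<le> a"
      by (auto simp: Chains_def relation_of_def)
    show "\<exists>u\<in>A. \<forall>a\<in>C. u \<le> a"
    proof (cases "C = {}")
      case True
      with assms show ?thesis by (auto simp: A_def)
    next
      case False
      have C: "\<And>q. q \<in> C \<Longrightarrow> norm_bounded_sublinear q" "\<And>q. q \<in> C \<Longrightarrow> q \<le> p"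
        using CA by (auto simp: A_def)
      note inf = norm_bounded_sublinear_INF[OF False C(1) chain]
      from False obtain c where "c \<in> C" by blast
      have "(\<lambda>x. INF q\<in>C. q x) \<in> A"
        using inf(1) order_trans[OF inf(2)[OF _ _ _ \<open>c \<in> C\<close>] C(2)[OF \<open>c \<in> C\<close>]]
        unfolding A_def by blast
      with inf(2) show ?thesis by blast
    qed
  qed
  then show ?thesis
    using that unfolding A_def by (metis (mono_tags, lifting) mem_Collect_eq order_trans)
qed

text \<open>A consequence usually drawn from the Hahn-Banach theorem.\<close>

lemma ex_norming_functional:
  fixes x :: "'a::real_normed_vector"
  assumes "x \<noteq> 0"
  obtains f :: "'a \<Rightarrow>\<^sub>L real" where "norm f = 1" "f x = norm x"
proof -
  have "norm_bounded_sublinear (norm :: 'a \<Rightarrow> real)"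
    by (simp add: norm_bounded_sublinear_def norm_triangle_ineq)
  then obtain p :: "'a \<Rightarrow> real" where p: "norm_bounded_sublinear p" "p (- x) \<le> - norm x"
    using sublinear_decrease[of norm x] by metis
  from ex_minimal_sublinear[OF p(1)]
  obtain q where q: "norm_bounded_sublinear q" "q \<le> p"
    and minimal: "\<And>r. norm_bounded_sublinear r \<Longrightarrow> r \<le> q \<Longrightarrow> r = q"
    by blast
  \<comment> \<open>By minimality, lowering \<open>q\<close> in the direction \<open>a\<close>
    returns \<open>q\<close> itself.\<close>
  have minus: "q (- a) = - q a" for a
  proof -
    obtain r where "norm_bounded_sublinear r" "\<And>x. r x \<le> q x" "r (- a) \<le> - q a"
      using sublinear_decrease[OF q(1)] by metis
    with minimal[of r] have "q (- a) \<le> - q a"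
      by (simp add: le_fun_def)
    with sublinear_minus[OF q(1), of a] show ?thesis by simp
  qed
  have abs: "norm (q a) \<le> norm a" for a
    using sublinear_le_norm[OF q(1), of a] sublinear_ge_norm[OF q(1), of a] by (simp add: abs_le_iff)
  have "bounded_linear q"
  proof (rule bounded_linear_intro)
    \<comment> \<open>Oddness turns subadditivity at \<open>- a\<close> and \<open>- b\<close> into
      superadditivity at \<open>a\<close> and \<open>b\<close>.\<close>
    show "q (a + b) = q a + q b" for a b
      using sublinear_add[OF q(1), of a b] sublinear_add[OF q(1), of "- a" "- b"] minus[of "a + b"]
      by (simp add: minus)
    show "q (t *\<^sub>R a) = t *\<^sub>R q a" for t a
      using sublinear_scaleR[OF q(1), of t a] sublinear_scaleR[OF q(1), of "- t" a]
        minus[of "t *\<^sub>R a"] by (cases "t \<ge> 0") simp_all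
    show "norm (q a) \<le> norm a * 1" for a
      using abs by simp
  qed
  then have apply_q: "blinfun_apply (Blinfun q) = q"
    by (rule bounded_linear_Blinfun_apply)
  \<comment> \<open>Oddness and \<open>q (- x) \<le> p (- x) \<le> - norm x\<close> give the lower
    bound.\<close>
  have "q x = norm x"
    using p(2) le_funD[OF q(2), of "- x"] minus[of x] sublinear_le_norm[OF q(1), of x] by simp
  moreover from this have "norm (Blinfun q) = 1"
    using assms by (intro norm_blinfun_eqI[where x = x]) (use abs in \<open>simp_all add: apply_q\<close>)
  ultimately show ?thesis
    using that[of "Blinfun q"] apply_q by simp
qed

section \<open>Daugavet constants of max-sums\<close>

text \<open>Otherwise \<open>norm f - \<eta>\<close> would bound \<open>f\<close>, and by symmetry
  its absolute value, on the unit ball, hence also the operator norm.\<close>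

lemma blinfun_almost_attains_norm:
  fixes f :: "'a::real_normed_vector \<Rightarrow>\<^sub>L real"
  assumes "\<eta> > 0"
  obtains v where "norm v \<le> 1" "f v > norm f - \<eta>"
proof (rule ccontr)
  assume "\<not> thesis"
  with that have le: "f v \<le> norm f - \<eta>" if "norm v \<le> 1" for v
    using that by force
  \<comment> \<open>\<open>norm_blinfun_bound\<close> asks for a nonnegative constant.\<close>
  from le[of 0] have nonneg: "norm f - \<eta> \<ge> 0" by simp
  have "norm f \<le> norm f - \<eta>"
  proof (rule norm_blinfun_bound[OF nonneg])
    fix x :: 'a
    have "norm (sgn x) \<le> 1"
      by (simp add: norm_sgn)
    then have "\<bar>f (sgn x)\<bar> \<le> norm f - \<eta>"
      using le[of "sgn x"] le[of "- sgn x"] by (simp add: blinfun.minus_right abs_le_iff)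
    then have "norm x * \<bar>f (sgn x)\<bar> \<le> norm x * (norm f - \<eta>)"
      by (rule mult_left_mono) simp
    moreover have "f x = norm x * f (sgn x)"
      by (cases "x = 0") (simp_all add: sgn_div_norm blinfun.scaleR_right)
    ultimately show "norm (f x) \<le> (norm f - \<eta>) * norm x"
      by (simp add: abs_mult mult.commute)
  qed
  with assms show False by simp
qed

text \<open>Isolates the condition under the supremum in \<open>dc\<close>, so that constants can be
  compared one \<alpha> at a time.\<close>

definition daugavet_bound :: "'a::banach \<Rightarrow> real \<Rightarrow> bool"
  where "daugavet_bound z \<alpha> \<longleftrightarrow> (\<forall>\<epsilon>>0. \<forall>\<delta>>0. \<forall>f\<in>sphere (0 :: 'a \<Rightarrow>\<^sub>L real) 1.
    \<exists>w\<in>slice f \<delta>. norm (w - z) > \<alpha> - \<epsilon>)"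

lemma dc_eq_Sup_daugavet_bound: "dc z = Sup (ereal ` {\<alpha>. \<alpha> \<ge> 0 \<and> daugavet_bound z \<alpha>})"
  by (simp add: dc_def daugavet_bound_def)

lemma daugavet_boundE:
  fixes z :: "'a::banach" and f :: "'a \<Rightarrow>\<^sub>L real"
  assumes "daugavet_bound z \<alpha>" "\<epsilon> > 0" "\<delta> > 0" "norm f = 1"
  obtains w where "norm w \<le> 1" "blinfun_apply f w > 1 - \<delta>" "norm (w - z) > \<alpha> - \<epsilon>"
proof -
  have "f \<in> sphere 0 1"
    using assms(4) by simp
  with assms(1-3) obtain w where "w \<in> slice f \<delta>" "norm (w - z) > \<alpha> - \<epsilon>"
    unfolding daugavet_bound_def by blast
  then show ?thesis
    using that by (auto simp: slice_def)
qed

text \<open>\<open>T\<close> and \<open>S\<close> stand for the two coordinate embeddings;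
  exchanging them gives both halves of the theorem from one argument.\<close>

lemma dc_le_dc_max_sum:
  fixes T :: "'a::banach \<Rightarrow> 'c::banach" and S :: "'b::banach \<Rightarrow> 'c"
  assumes "linear T" "linear S"
    and norm: "\<And>u v. norm (T u + S v) = max (norm u) (norm v)"
    and surj: "\<And>z. \<exists>u v. z = T u + S v"
    and x: "norm x = 1"
  shows "dc x \<le> dc (T x + S y)"
proof -
  interpret T: linear T by fact
  interpret S: linear S by fact
  have norm_T: "norm (T u) = norm u" for u
    using norm[of u 0] by (simp add: S.zero)
  have norm_S: "norm (S v) = norm v" for v
    using norm[of 0 v] by (simp add: T.zero)
  have T: "bounded_linear T" and S: "bounded_linear S"
    by (auto intro!: bounded_linear_intro[where K = 1]
        simp: T.add T.scale S.add S.scale norm_T norm_S)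
  have "daugavet_bound (T x + S y) \<alpha>" if \<alpha>: "daugavet_bound x \<alpha>" for \<alpha>
    unfolding daugavet_bound_def
  proof (intro allI impI ballI)
    fix \<epsilon> \<delta> :: real and f :: "'c \<Rightarrow>\<^sub>L real"
    assume "\<epsilon> > 0" "\<delta> > 0" "f \<in> sphere 0 1"
    define g where "g = f o\<^sub>L Blinfun T"
    define h where "h = f o\<^sub>L Blinfun S"
    have f_eq: "f (T u + S v) = g u + h v" for u v
      by (simp add: g_def h_def bounded_linear_Blinfun_apply T S blinfun.add_right)
    \<comment> \<open>This half of \<open>norm f = norm g + norm h\<close> puts the chosen point
      into the slice; each coordinate may then lose \<open>\<delta> / 2\<close>.\<close>
    have "norm f \<le> norm g + norm h"
    proof (rule norm_blinfun_bound)
      fix z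
      obtain u v where z: "z = T u + S v"
        using surj by blast
      have "norm (f z) \<le> norm (g u) + norm (h v)"
        unfolding z f_eq by (rule norm_triangle_ineq)
      also have "\<dots> \<le> norm g * norm u + norm h * norm v"
        by (intro add_mono norm_blinfun)
      also have "\<dots> \<le> norm g * norm z + norm h * norm z"
        by (intro add_mono mult_left_mono) (simp_all add: z norm)
      finally show "norm (f z) \<le> (norm g + norm h) * norm z"
        by (simp add: distrib_right)
    qed simp
    with \<open>f \<in> sphere 0 1\<close> have sum_ge: "norm g + norm h \<ge> 1" by simp
    obtain u where u: "norm u \<le> 1" "g u > norm g - \<delta> / 2" "norm (u - x) > \<alpha> - \<epsilon>"
    proof (cases "g = 0")
      case True
      \<comment> \<open>The functional \<open>e\<close> and the point \<open>w\<close> serve only to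
        show \<open>\<alpha> - \<epsilon> < 2\<close>; the point taken for \<open>u\<close> is
        \<open>- x\<close>.\<close>
      from x have "x \<noteq> 0" by auto
      then obtain e :: "'a \<Rightarrow>\<^sub>L real" where e: "norm e = 1"
        by (rule ex_norming_functional)
      obtain w where "norm w \<le> 1" "norm (w - x) > \<alpha> - \<epsilon>"
        by (rule daugavet_boundE[OF \<alpha> \<open>\<epsilon> > 0\<close> \<open>\<delta> > 0\<close> e])
      moreover have "norm (w - x) \<le> norm w + norm x"
        by (rule norm_triangle_ineq4)
      moreover have "norm (- x - x) = 2"
        using x norm_scaleR[of "- 2" x] by (simp add: scaleR_2)
      ultimately show ?thesis
        using that[of "- x"] True x \<open>\<delta> > 0\<close> by simp
    next
      case False
      define e where "e = g /\<^sub>R norm g"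
      have e: "norm e = 1"
        using False by (simp add: e_def)
      \<comment> \<open>Multiplying by \<open>norm g\<close> to return from \<open>e\<close> to
        \<open>g\<close> turns this width into \<open>\<delta> / 2\<close>.\<close>
      have "\<delta> / (2 * norm g) > 0"
        using False \<open>\<delta> > 0\<close> by simp
      from daugavet_boundE[OF \<alpha> \<open>\<epsilon> > 0\<close> this e]
      obtain w where w: "norm w \<le> 1" "e w > 1 - \<delta> / (2 * norm g)" "norm (w - x) > \<alpha> - \<epsilon>" .
      have "norm g * (1 - \<delta> / (2 * norm g)) < norm g * e w"
        using w(2) False by (intro mult_strict_left_mono) simp_all
      then have "g w > norm g - \<delta> / 2"
        using False by (simp add: e_def blinfun.scaleR_left right_diff_distrib flip: mult.assoc)
      with w that show ?thesis by blast
    qed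
    obtain v where v: "norm v \<le> 1" "h v > norm h - \<delta> / 2"
      using blinfun_almost_attains_norm[of "\<delta> / 2" h] \<open>\<delta> > 0\<close> by auto
    have "T u + S v \<in> slice f \<delta>"
      using u v sum_ge by (simp add: slice_def norm f_eq)
    moreover have "T u + S v - (T x + S y) = T (u - x) + S (v - y)"
      by (simp add: T.diff S.diff)
    \<comment> \<open>The max norm dominates the distance in the first coordinate, wherever
      \<open>v\<close> lies.\<close>
    with u(3) norm[of "u - x" "v - y"]
    have "norm (T u + S v - (T x + S y)) > \<alpha> - \<epsilon>" by simp
    ultimately show "\<exists>w\<in>slice f \<delta>. norm (w - (T x + S y)) > \<alpha> - \<epsilon>" by blast
  qed
  \<comment> \<open>The supremum for the sum runs over a larger set.\<close>
  then show ?thesis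
    unfolding dc_eq_Sup_daugavet_bound by (intro Sup_subset_mono image_mono) blast
qed

theorem proposition4p3:
  fixes x :: "'a::banach" and y :: "'b::banach"
  assumes "Inf_Pair x y \<in> sphere 0 1"
  shows "(norm x = 1 \<longrightarrow> dc (Inf_Pair x y) \<ge> dc x) \<and>
    (norm y = 1 \<longrightarrow> dc (Inf_Pair x y) \<ge> dc y)"
proof -
  define T :: "'a \<Rightarrow> 'a \<oplus>\<^sub>\<infinity> 'b" where "T u = Inf_Pair u 0" for u
  define S :: "'b \<Rightarrow> 'a \<oplus>\<^sub>\<infinity> 'b" where "S v = Inf_Pair 0 v" for v
  have linear: "linear T" "linear S"
    by (auto intro!: linearI simp: T_def S_def plus_inf_sum_def scaleR_inf_sum_def)
  have sum: "T u + S v = Inf_Pair u v" "S v + T u = Inf_Pair u v" for u v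
    by (simp_all add: T_def S_def plus_inf_sum_def)
  have norm: "norm (Inf_Pair u v) = max (norm u) (norm v)" for u :: 'a and v :: 'b
    by (simp add: norm_inf_sum_def)
  have surj: "\<exists>u v. z = Inf_Pair u v" for z :: "'a \<oplus>\<^sub>\<infinity> 'b"
    by (cases z) simp
  have "dc x \<le> dc (T x + S y)" if "norm x = 1"
    using that surj by (intro dc_le_dc_max_sum[OF linear]) (simp_all add: sum norm)
  moreover have "dc y \<le> dc (S y + T x)" if "norm y = 1"
    by (rule dc_le_dc_max_sum[OF linear(2,1)])
      (use that surj in \<open>simp_all add: sum norm max.commute, blast\<close>)
  ultimately show ?thesis
    by (simp add: sum)
qed

end
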